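(* Let $\Delta t>0$ denote the time step. Applying a Runge--Kutta method with stability function $R(z)$ to the Fourier-mode equation $$\frac{\mathrm d}{\mathrm dt}\hat\eta_{\mathbf k}(t)=\lambda(\mathbf k)\,\hat\eta_{\mathbf k}(t)$$ yields $$e^{\Delta t\,\tilde\lambda(\mathbf k)}=R\bigl(\Delta t\,\lambda(\mathbf k)\bigr),$$ where $\tilde\lambda(\mathbf k)$ is the discrete growth rate.
   Context: $\lambda(\mathbf k)=\lambda(\mathbf k;u_0)=-M|\mathbf k|^2\bigl(|\mathbf k|^2+\varepsilon^{-2}F''(u_0)+\beta|\mathbf k|^4\bigr)$ is the growth rate of the Fourier mode with wavevector $\mathbf k$ for the isotropic Cahn--Hilliard equation linearized around the constant state $u_0$ (constants $M>0$, $\varepsilon>0$, $\beta\ge0$, $F$ the bulk potential). For a Runge--Kutta method with coefficient matrix $\mathcal A$ and weights $\mathsf b$, the stability function is $R(z)=1+z\,\mathsf b^\top(I-z\mathcal A)^{-1}\mathbf 1$, with $\mathbf 1$ the all-ones vector (defined when $I-z\mathcal A$ is invertible, which is assumed at $z=\Delta t\lambda(\mathbf k)$). The discrete growth rate $\tilde\lambda(\mathbf k)\in\mathbb{C}$ is defined by writing the numerical solution of the mode equation as $\hat u^n=U_0\,e^{n\Delta t\,\tilde\lambda(\mathbf k)}$ for all $n\ge0$, with $U_0\ne0$. *)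

theory Defs
  imports "HOL-Analysis.Analysis"
begin

definition growth_rate ::
  "real \<Rightarrow> real \<Rightarrow> real \<Rightarrow> (real \<Rightarrow> real) \<Rightarrow> real \<Rightarrow> real ^ 'd \<Rightarrow> real" where
  "growth_rate M \<epsilon> \<beta> F u0 k =
     - M * (norm k)\<^sup>2 * ((norm k)\<^sup>2 + deriv (deriv F) u0 / \<epsilon>\<^sup>2 + \<beta> * norm k ^ 4)"

text \<open>One step of size \<open>dt\<close>, from \<open>y\<close> to \<open>y'\<close>, of the Runge--Kutta method with
  coefficients \<open>A\<close> and weights \<open>b\<close> for the autonomous equation \<open>y' = f y\<close>. The method may be
  implicit, so a step is a relation: the internal stages \<open>Y\<close> are required to solve the stage
  equations. The index type \<open>'s\<close> enumerates the stages.\<close>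

definition rk_step ::
  "real ^ 's ^ 's \<Rightarrow> real ^ 's \<Rightarrow> ('a::real_vector \<Rightarrow> 'a) \<Rightarrow> real \<Rightarrow> 'a \<Rightarrow> 'a \<Rightarrow> bool" where
  "rk_step A b f dt y y' \<longleftrightarrow>
     (\<exists>Y. (\<forall>i. Y i = y + dt *\<^sub>R (\<Sum>j\<in>UNIV. (A $ i $ j) *\<^sub>R f (Y j))) \<and>
          y' = y + dt *\<^sub>R (\<Sum>i\<in>UNIV. (b $ i) *\<^sub>R f (Y i)))"

definition rk_solution ::
  "real ^ 's ^ 's \<Rightarrow> real ^ 's \<Rightarrow> ('a::real_vector \<Rightarrow> 'a) \<Rightarrow> real \<Rightarrow> (nat \<Rightarrow> 'a) \<Rightarrow> bool" where
  "rk_solution A b f dt u \<longleftrightarrow> (\<forall>n. rk_step A b f dt (u n) (u (Suc n)))"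

text \<open>The complex matrix \<open>I - z A\<close>.\<close>

definition rk_matrix :: "real ^ 's ^ 's \<Rightarrow> complex \<Rightarrow> complex ^ 's ^ 's" where
  "rk_matrix A z = mat 1 - (\<chi> i j. z * complex_of_real (A $ i $ j))"

text \<open>Meaningful only where \<open>rk_matrix A z\<close> is invertible; elsewhere \<open>matrix_inv\<close> is unspecified.
  In the vector type, \<open>1\<close> is the all-ones vector.\<close>

definition rk_stability :: "real ^ 's ^ 's \<Rightarrow> real ^ 's \<Rightarrow> complex \<Rightarrow> complex" where
  "rk_stability A b z =
     1 + z * (\<Sum>i\<in>UNIV. complex_of_real (b $ i) * (matrix_inv (rk_matrix A z) *v 1) $ i)"

text \<open>A relation rather than a function: a discrete growth rate is determined only modulo
  \<open>2 \<pi> \<i> / dt\<close>.\<close>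

definition is_discrete_growth_rate :: "(nat \<Rightarrow> complex) \<Rightarrow> real \<Rightarrow> complex \<Rightarrow> bool" where
  "is_discrete_growth_rate u dt \<mu> \<longleftrightarrow>
     (\<exists>U0. U0 \<noteq> 0 \<and> (\<forall>n. u n = U0 * exp (of_nat n * complex_of_real dt * \<mu>)))"

end

theory Submission imports Defs begin

text \<open>For a linear right-hand side \<open>l * y\<close> the stage equations form the linear
  system (I - z A) Y = y 1 with z = dt l. Invertibility of I - z A forces Y = y (I - z A)^{-1} 1,
  and inserting this into the update gives y' = R(z) y; this is \<open>rk_step_linear\<close>. The
  step from \<open>u 0\<close> to \<open>u 1\<close> therefore multiplies by R(z), while the
  exponential form of the solution makes the same factor exp(dt \<mu>).\<close>

lemma rk_matrix_mult_vec_nth: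
  "(rk_matrix A z *v v) $ i = v $ i - z * (\<Sum>j\<in>UNIV. complex_of_real (A $ i $ j) * v $ j)"
proof -
  have "rk_matrix A z *v v = v - (\<chi> i j. z * complex_of_real (A $ i $ j)) *v v"
    by (simp add: rk_matrix_def matrix_vector_mult_diff_rdistrib)
  then show ?thesis
    by (simp add: matrix_vector_mult_def sum_distrib_left mult.assoc)
qed

text \<open>\<open>matrix_inv\<close> is a Hilbert choice of a two-sided inverse;
  \<open>invertible\<close> supplies the existence that makes the choice meaningful.\<close>

lemma matrix_inv_mult:
  assumes "invertible A"
  shows "matrix_inv A ** A = mat 1"
  using someI_ex[OF assms[unfolded invertible_def]] by (simp add: matrix_inv_def)

text \<open>A step supplies some stages as witnesses; invertibility makes them unique, so the
  relation \<open>rk_step\<close> determines \<open>y'\<close> from \<open>y\<close>.\<close>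

lemma rk_step_linear:
  fixes l :: complex
  assumes inv: "invertible (rk_matrix A (complex_of_real dt * l))"
    and step: "rk_step A b (\<lambda>y. l * y) dt y y'"
  shows "y' = rk_stability A b (complex_of_real dt * l) * y"
proof -
  define z where "z = complex_of_real dt * l"
  let ?B = "rk_matrix A z"
  let ?w = "matrix_inv ?B *v 1"
  obtain Y where Y: "\<And>i. Y i = y + dt *\<^sub>R (\<Sum>j\<in>UNIV. (A $ i $ j) *\<^sub>R (l * Y j))"
    and y': "y' = y + dt *\<^sub>R (\<Sum>i\<in>UNIV. (b $ i) *\<^sub>R (l * Y i))"
    using step unfolding rk_step_def by blast
  have stage: "Y i = y + z * (\<Sum>j\<in>UNIV. complex_of_real (A $ i $ j) * Y j)" for i
    using Y[of i] by (simp only: z_def scaleR_conv_of_real sum_distrib_left mult_ac)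
  have "?B *v (\<chi> i. Y i) = y *s 1"
  proof (subst vec_eq_iff, intro allI)
    show "(?B *v (\<chi> i. Y i)) $ i = (y *s 1) $ i" for i
      using stage[of i] by (simp add: rk_matrix_mult_vec_nth del: vec_lambda_eta)
  qed
  moreover have "matrix_inv ?B ** ?B = mat 1"
    using inv unfolding z_def by (rule matrix_inv_mult)
  \<comment> \<open>Multiply the stage system by the inverse on the left and pull the scalar
    \<open>y\<close> out.\<close>
  ultimately have "(\<chi> i. Y i) = y *s ?w"
    by (metis matrix_vector_mul_assoc matrix_vector_mul_lid vector_scalar_commute)
  then have Y_eq: "Y i = y * ?w $ i" for i
    by (simp add: vec_eq_iff)
  have "y' = y + z * (\<Sum>i\<in>UNIV. complex_of_real (b $ i) * Y i)"
    by (simp only: y' z_def scaleR_conv_of_real sum_distrib_left mult_ac)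
  \<comment> \<open>Every stage is a multiple of \<open>y\<close>, so \<open>y\<close> factors out
    and leaves the formula for R(z).\<close>
  also have "\<dots> = rk_stability A b z * y"
    by (simp add: Y_eq rk_stability_def sum_distrib_left sum_distrib_right algebra_simps)
  finally show ?thesis
    by (simp add: z_def)
qed

theorem proposition4p2:
  fixes M \<epsilon> \<beta> u0 dt :: real
    and F :: "real \<Rightarrow> real"
    and k :: "real ^ 'd"
    and A :: "real ^ 's ^ 's"
    and b :: "real ^ 's"
    and u :: "nat \<Rightarrow> complex"
    and \<mu> :: complex
  assumes "M > 0" and "\<epsilon> > 0" and "\<beta> \<ge> 0"
    and "\<forall>\<^sub>F x in nhds u0. F differentiable (at x)"
    and "deriv F differentiable (at u0)"
    and "dt > 0"
    and "invertible (rk_matrix A (complex_of_real (dt * growth_rate M \<epsilon> \<beta> F u0 k)))"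
    and "rk_solution A b (\<lambda>y. complex_of_real (growth_rate M \<epsilon> \<beta> F u0 k) * y) dt u"
    and "is_discrete_growth_rate u dt \<mu>"
  shows "exp (complex_of_real dt * \<mu>)
       = rk_stability A b (complex_of_real (dt * growth_rate M \<epsilon> \<beta> F u0 k))"
proof -
  let ?l = "complex_of_real (growth_rate M \<epsilon> \<beta> F u0 k)"
  have "u 1 = rk_stability A b (complex_of_real dt * ?l) * u 0"
    using assms(7,8) by (intro rk_step_linear) (simp_all add: rk_solution_def)
  moreover obtain U0 where "U0 \<noteq> 0"
    and "\<And>n. u n = U0 * exp (of_nat n * complex_of_real dt * \<mu>)"
    using assms(9) unfolding is_discrete_growth_rate_def by blast
  \<comment> \<open>At n = 0 the exponential is 1, so \<open>u 0\<close> is \<open>U0\<close>; at n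
    = 1 the nonzero factor \<open>U0\<close> cancels.\<close>
  ultimately show ?thesis
    by simp
qed

end
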